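(* Let $n\in\mathbb{Z}$, $n\ge 2$, and let $k\in\mathbb{Z}$, $k\ge 0$. Let $\{E_j\}_{j=-k}^{k}$ be any sequence of pairwise disjoint open intervals such that $E_0=(-b_0,b_0)$ with $b_0>0$, $E_j=(a_j,b_j)$ and $E_{-j}=-E_j$ for $j=1,\dots,k$, where $$b_0<a_1<b_1<a_2<b_2<\dots<a_k<b_k ,$$ and where $b_k=+\infty$ is allowed. Then there exists $f\in CH(\mathbb{R})$ such that $S_f=\bigcup_{j=-k}^{k}E_j$ and $$\mathrm{card}(C_n(f))=n^k .$$
   Context: $CH(\mathbb{R})$ denotes the set of characteristic functions of Borel probability measures on $\mathbb{R}$, i.e. functions $f:\mathbb{R}\to\mathbb{C}$ of the form $f(x)=\int_{\mathbb{R}}e^{itx}\,d\mu(t)$, $x\in\mathbb{R}$, with $\mu$ a Borel probability measure on $\mathbb{R}$. For $f\in CH(\mathbb{R})$ and an integer $n\ge 2$, $C_n(f)=\{g\in CH(\mathbb{R}): g(x)^n=f(x)^n \text{ for all } x\in\mathbb{R}\}$. For $f\in CH(\mathbb{R})$, $S_f=\{x\in\mathbb{R}: f(x)\ne 0\}$. For a set $E\subset\mathbb{R}$, $-E=\{-x:x\in E\}$. $\mathrm{card}$ denotes cardinality. *)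

theory Defs
  imports "HOL-Probability.Probability"
begin

definition CH :: "(real \<Rightarrow> complex) set" where
  "CH = {f. \<exists>M. real_distribution M \<and> f = char M}"

definition C_roots :: "nat \<Rightarrow> (real \<Rightarrow> complex) \<Rightarrow> (real \<Rightarrow> complex) set" where
  "C_roots n f = {g \<in> CH. \<forall>x. g x ^ n = f x ^ n}"

definition nonzero_set :: "(real \<Rightarrow> complex) \<Rightarrow> real set" where
  "nonzero_set f = {x. f x \<noteq> 0}"

end

theory Submission
  imports Defs
begin

text \<open>The function \<open>(max 0 (1 - |x| / w))\<^sup>2\<close> has a spectral density lying between two positive
  multiples of \<open>1 / (1 + t\<^sup>2)\<close>. Take it, with support \<open>E 0\<close>, as the main term, and let \<open>\<psi> j\<close> be
  a translate of another such function with support \<open>E j\<close> (a geometrically weighted sum of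
  translates if \<open>E j\<close> is a half-line). The spectral densities of the \<open>\<psi> j\<close> are dominated by the main
  one, so adding small multiples of \<open>e j * \<psi> j x + cnj (e j * \<psi> j (- x))\<close> to the main term
  keeps the density nonnegative for every choice of \<open>n\<close>-th roots of unity \<open>e j\<close>. This gives \<open>n ^ k\<close>
  characteristic functions with the same \<open>n\<close>-th power. There are no others: the quotient of two of
  them is a continuous root of unity, hence constant on each interval; it is \<open>1\<close> on \<open>E 0\<close>,
  and its values on \<open>E j\<close> and \<open>E (- j)\<close> are conjugate. If \<open>b 0 = \<infinity>\<close>, then
  \<open>k = 0\<close> and the Gaussian serves as main term.\<close>

subsection \<open>Fourier inversion\<close>

lemma integrable_iexp_mult:
  fixes q :: "real \<Rightarrow> complex"
  assumes "integrable lborel q"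
  shows "integrable lborel (\<lambda>t. iexp (x * t) * q t)"
  by (rule Bochner_Integration.integrable_bound[OF assms])
     (use assms in \<open>auto simp: norm_mult\<close>)

text \<open>Sign and normalisation agree with \<open>char\<close>, so the transform of a probability
  density is its characteristic function. The reverse transform is written with the argument
  \<open>- t\<close> and no extra factor, hence the \<open>2 * pi\<close> in the inversion
  formula.\<close>

definition fourier :: "(real \<Rightarrow> complex) \<Rightarrow> real \<Rightarrow> complex" where
  "fourier q x = (CLINT t|lborel. iexp (x * t) * q t)"

lemma fourier_std_normal_density:
  "fourier (\<lambda>t. complex_of_real (std_normal_density t)) x = exp (- (x\<^sup>2) / 2)"
proof -
  have "fourier (\<lambda>t. complex_of_real (std_normal_density t)) x = char std_normal_distribution x"
    unfolding fourier_def char_def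
    by (subst integral_density) (auto simp: scaleR_conv_of_real mult.commute)
  then show ?thesis
    by (simp add: char_std_normal_distribution)
qed

lemma fourier_gaussian:
  assumes "s > 0"
  shows "fourier (\<lambda>t. complex_of_real (exp (- ((s * t)\<^sup>2) / 2))) z
    = complex_of_real (sqrt (2 * pi) / s * exp (- ((z / s)\<^sup>2) / 2))"
proof -
  have "fourier (\<lambda>t. complex_of_real (std_normal_density t)) (z / s)
      = of_real s * (CLINT t|lborel. iexp (z * t) * complex_of_real (std_normal_density (s * t)))"
    unfolding fourier_def using assms
    by (subst lborel_integral_real_affine[where c=s and t=0]) (auto simp: scaleR_conv_of_real)
  also have "(CLINT t|lborel. iexp (z * t) * complex_of_real (std_normal_density (s * t)))
      = fourier (\<lambda>t. complex_of_real (exp (- ((s * t)\<^sup>2) / 2))) z / sqrt (2 * pi)"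
    unfolding fourier_def by (subst integral_divide_zero[symmetric]) (simp add: std_normal_density_def)
  finally show ?thesis
    using assms by (simp add: fourier_std_normal_density field_simps)
qed

lemma integrable_gaussian:
  assumes "s > 0"
  shows "integrable lborel (\<lambda>t::real. exp (- ((s * t)\<^sup>2) / 2))"
proof -
  have "integrable lborel (\<lambda>t. std_normal_density (0 + s * t))"
    by (subst lborel_integrable_real_affine_iff) (use assms in auto)
  then have "integrable lborel (\<lambda>t. sqrt (2 * pi) * std_normal_density (s * t))"
    by (intro integrable_mult_right) simp
  then show ?thesis by (simp add: std_normal_density_def)
qed

text \<open>The Gaussian factor makes the double integral absolutely convergent, with dominating
  function the product of the Gaussian in \<open>t\<close> and \<open>\<phi> y\<close>, so Fubini
  applies. The inner integral over \<open>t\<close> is then the transform of a Gaussian, a peak of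
  width \<open>s\<close> around \<open>x\<close>, and the substitution \<open>y = x + s * v\<close>
  rescales it to the standard normal density.\<close>

lemma gaussian_regularization:
  fixes \<phi> :: "real \<Rightarrow> complex"
  assumes \<phi>: "integrable lborel \<phi>" and s: "s > 0"
  shows "(CLINT t|lborel. iexp (x * t) * fourier \<phi> (- t) * complex_of_real (exp (- ((s * t)\<^sup>2) / 2)))
    = 2 * pi * (CLINT v|lborel. \<phi> (x + s * v) * std_normal_density v)"
proof -
  note [measurable] = borel_measurable_integrable[OF \<phi>]
  let ?g = "\<lambda>t. complex_of_real (exp (- ((s * t)\<^sup>2) / 2))"
  let ?f = "\<lambda>t y. iexp ((x - y) * t) * \<phi> y * ?g t"
  have int: "integrable (lborel \<Otimes>\<^sub>M lborel) (case_prod ?f)"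
  proof (rule Bochner_Integration.integrable_bound)
    show "integrable (lborel \<Otimes>\<^sub>M lborel) (\<lambda>(t, y). ?g t * \<phi> y)"
      by (intro lborel_pair.Fubini_integrable)
         (use \<phi> integrable_gaussian[OF s] in
           \<open>auto simp: norm_mult intro!: integrable_mult_right integrable_mult_left\<close>)
  qed (auto simp: norm_mult split_beta')
  have "(CLINT t|lborel. iexp (x * t) * fourier \<phi> (- t) * ?g t) = (CLINT t|lborel. CLINT y|lborel. ?f t y)"
  proof (intro Bochner_Integration.integral_cong refl)
    fix t
    have "(CLINT y|lborel. ?f t y) = (CLINT y|lborel. (iexp (x * t) * ?g t) * (iexp (- t * y) * \<phi> y))"
      by (intro Bochner_Integration.integral_cong refl) (simp add: algebra_simps flip: exp_add)
    also have "\<dots> = (iexp (x * t) * ?g t) * fourier \<phi> (- t)"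
      unfolding fourier_def by (subst integral_mult_right_zero) simp
    finally show "iexp (x * t) * fourier \<phi> (- t) * ?g t = (CLINT y|lborel. ?f t y)"
      by (simp add: mult_ac)
  qed
  also have "\<dots> = (CLINT y|lborel. CLINT t|lborel. ?f t y)"
    by (rule lborel_pair.Fubini_integral[OF int, symmetric])
  also have "\<dots> = (CLINT y|lborel. \<phi> y * (sqrt (2 * pi) / s * exp (- (((x - y) / s)\<^sup>2) / 2)))"
  proof (intro Bochner_Integration.integral_cong refl)
    fix y
    have "(CLINT t|lborel. ?f t y) = (CLINT t|lborel. \<phi> y * (iexp ((x - y) * t) * ?g t))"
      by (intro Bochner_Integration.integral_cong refl) (simp add: mult_ac)
    also have "\<dots> = \<phi> y * fourier ?g (x - y)"
      unfolding fourier_def by (subst integral_mult_right_zero) simp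
    finally show "(CLINT t|lborel. ?f t y) = \<phi> y * (sqrt (2 * pi) / s * exp (- (((x - y) / s)\<^sup>2) / 2))"
      by (subst (asm) fourier_gaussian[OF s]) simp
  qed
  also have "\<dots> = s * (CLINT v|lborel. \<phi> (x + s * v) * (sqrt (2 * pi) / s * exp (- (((x - (x + s * v)) / s)\<^sup>2) / 2)))"
    using s by (subst lborel_integral_real_affine[where c=s and t=x]) (auto simp: scaleR_conv_of_real)
  also have "\<dots> = (CLINT v|lborel. (2 * pi) * (\<phi> (x + s * v) * std_normal_density v))"
    using s by (subst integral_mult_right_zero[symmetric], intro Bochner_Integration.integral_cong refl)
      (simp add: std_normal_density_def field_simps flip: of_real_mult power2_eq_square)
  finally show ?thesis
    by (simp add: mult.assoc)
qed

text \<open>Let \<open>s\<close> tend to \<open>0\<close> in the regularized identity. Dominated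
  convergence applies on both sides: on the left the modulus of the transform dominates, on the
  right the bound \<open>B\<close> times the normal density; continuity at \<open>x\<close>
  identifies the right-hand limit.\<close>

theorem fourier_inversion:
  fixes \<phi> :: "real \<Rightarrow> complex"
  assumes \<phi>: "integrable lborel \<phi>" and F: "integrable lborel (\<lambda>t. fourier \<phi> (- t))"
    and bound: "\<And>y. norm (\<phi> y) \<le> B" and cont: "isCont \<phi> x"
  shows "fourier (\<lambda>t. fourier \<phi> (- t)) x = 2 * pi * \<phi> x"
proof -
  note [measurable] = borel_measurable_integrable[OF \<phi>] borel_measurable_integrable[OF F]
  define s where "s n = inverse (real (Suc n))" for n
  have s: "s n > 0" for n by (simp add: s_def)
  have s0: "s \<longlonglongrightarrow> 0" unfolding s_def by (rule LIMSEQ_inverse_real_of_nat)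
  let ?L = "\<lambda>n. CLINT t|lborel. iexp (x * t) * fourier \<phi> (- t) * complex_of_real (exp (- ((s n * t)\<^sup>2) / 2))"
  have "?L \<longlonglongrightarrow> fourier (\<lambda>t. fourier \<phi> (- t)) x"
    unfolding fourier_def[of "\<lambda>t. fourier \<phi> (- t)"]
  proof (rule integral_dominated_convergence[where w="\<lambda>t. norm (fourier \<phi> (- t))"])
    show "AE t in lborel. (\<lambda>n. iexp (x * t) * fourier \<phi> (- t) * complex_of_real (exp (- ((s n * t)\<^sup>2) / 2)))
        \<longlonglongrightarrow> iexp (x * t) * fourier \<phi> (- t)"
    proof (intro AE_I2)
      fix t
      have "(\<lambda>n. iexp (x * t) * fourier \<phi> (- t) * complex_of_real (exp (- ((s n * t)\<^sup>2) / 2)))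
        \<longlonglongrightarrow> iexp (x * t) * fourier \<phi> (- t) * complex_of_real (exp (- ((0 * t)\<^sup>2) / 2))"
        by (intro tendsto_intros s0) auto
      then show "(\<lambda>n. iexp (x * t) * fourier \<phi> (- t) * complex_of_real (exp (- ((s n * t)\<^sup>2) / 2)))
        \<longlonglongrightarrow> iexp (x * t) * fourier \<phi> (- t)" by simp
    qed
  qed (use F in \<open>auto simp: norm_mult intro!: mult_left_le\<close>)
  moreover have "?L = (\<lambda>n. 2 * pi * (CLINT v|lborel. \<phi> (x + s n * v) * std_normal_density v))"
    by (intro ext gaussian_regularization[OF \<phi> s])
  moreover have "(\<lambda>n. CLINT v|lborel. \<phi> (x + s n * v) * std_normal_density v)
      \<longlonglongrightarrow> (CLINT v|lborel. \<phi> x * std_normal_density v)"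
  proof (rule integral_dominated_convergence[where w="\<lambda>v. B * std_normal_density v"])
    show "AE v in lborel. (\<lambda>n. \<phi> (x + s n * v) * std_normal_density v) \<longlonglongrightarrow> \<phi> x * std_normal_density v"
    proof (intro AE_I2 tendsto_mult_right isCont_tendsto_compose[OF cont])
      fix v
      have "(\<lambda>n. x + s n * v) \<longlonglongrightarrow> x + 0 * v" by (intro tendsto_intros s0)
      then show "(\<lambda>n. x + s n * v) \<longlonglongrightarrow> x" by simp
    qed
  qed (auto simp: norm_mult bound intro!: mult_right_mono)
  moreover have "(CLINT v|lborel. \<phi> x * std_normal_density v) = \<phi> x"
    by (subst integral_mult_right_zero) (simp)
  ultimately have "(\<lambda>n. 2 * pi * (CLINT v|lborel. \<phi> (x + s n * v) * std_normal_density v))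
        \<longlonglongrightarrow> fourier (\<lambda>t. fourier \<phi> (- t)) x"
    and "(\<lambda>n. 2 * pi * (CLINT v|lborel. \<phi> (x + s n * v) * std_normal_density v))
        \<longlonglongrightarrow> 2 * pi * \<phi> x"
    by (auto intro!: tendsto_mult_left)
  then show ?thesis by (rule LIMSEQ_unique)
qed

subsection \<open>Squared triangles and their spectral densities\<close>

text \<open>\<open>bump w\<close> has Fourier transform \<open>2 * pi * bump_kernel w\<close> away from the origin;
  at \<open>t = 0\<close> division by zero gives \<open>0\<close> instead of the limit \<open>w / (3 * pi)\<close>.\<close>

definition bump_kernel :: "real \<Rightarrow> real \<Rightarrow> real" where
  "bump_kernel w t = 2 * (w * t - sin (w * t)) / (pi * w\<^sup>2 * t ^ 3)"

definition bump :: "real \<Rightarrow> real \<Rightarrow> real" where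
  "bump w x = (max 0 (1 - \<bar>x\<bar> / w))\<^sup>2"

section \<open>Two-sided estimates for the kernel\<close>

lemma measurable_bump_kernel [measurable]: "bump_kernel w \<in> borel_measurable borel"
  unfolding bump_kernel_def by measurable

text \<open>The difference behaves like \<open>u ^ 3 / 6\<close> near \<open>0\<close> and like
  \<open>u\<close> at infinity, and \<open>u ^ 3 / (1 + u\<^sup>2)\<close> has both orders of
  growth. Taylor expansion handles small \<open>u\<close>, boundedness of the sine handles large
  \<open>u\<close>.\<close>

lemma diff_sin_bounds:
  fixes u :: real
  assumes "u > 0"
  shows "u ^ 3 / (10 * (1 + u\<^sup>2)) \<le> u - sin u" and "u - sin u \<le> 4 * u ^ 3 / (1 + u\<^sup>2)"
proof -
  \<comment> \<open>The sine has no term of degree 4, so the cubic polynomial already has a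
    remainder of order five.\<close>
  have "(\<Sum>m<5. sin_coeff m * u ^ m) = u - u ^ 3 / 6"
    by (simp add: sin_coeff_def lessThan_nat_numeral lessThan_Suc fact_numeral)
  then have "\<bar>sin u - (u - u ^ 3 / 6)\<bar> \<le> u ^ 5 / 120"
    using Maclaurin_sin_bound[of u 5] assms by (simp add: fact_numeral)
  then have taylor: "u ^ 3 / 6 - u ^ 5 / 120 \<le> u - sin u" "u - sin u \<le> u ^ 3 / 6 + u ^ 5 / 120"
    by linarith+
  have pos: "1 + u\<^sup>2 > 0" by (simp add: add_pos_nonneg)
  have power_nonneg: "u ^ 3 \<ge> 0" using assms by simp
  show "u ^ 3 / (10 * (1 + u\<^sup>2)) \<le> u - sin u"
  \<comment> \<open>Up to \<open>2\<close> the quintic term costs at most \<open>u ^ 3 / 30\<close>,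
    leaving \<open>2 / 15\<close> of \<open>u ^ 3\<close>, more than the required tenth.\<close>
  proof (cases "u \<le> 2")
    case True
    have "u ^ 3 / (10 * (1 + u\<^sup>2)) \<le> u ^ 3 / 10"
      using assms by (intro divide_left_mono) (auto simp: add_pos_nonneg)
    also have "\<dots> \<le> u ^ 3 / 6 - u ^ 5 / 120"
    proof -
      have "u ^ 5 = u ^ 3 * u\<^sup>2" by (simp add: flip: power_add)
      also have "\<dots> \<le> u ^ 3 * 2\<^sup>2"
        using True assms by (intro mult_left_mono power_mono) auto
      finally have "u ^ 5 \<le> 4 * u ^ 3" by simp
      then show ?thesis using power_nonneg by linarith
    qed
    finally show ?thesis using taylor by linarith
  next
    case False
    have "u ^ 3 / (10 * (1 + u\<^sup>2)) \<le> u ^ 3 / (10 * u\<^sup>2)"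
      using assms by (intro divide_left_mono) (auto simp: add_pos_nonneg)
    also have "\<dots> = u / 10" using assms by (simp add: field_simps power2_eq_square power3_eq_cube)
    also have "\<dots> \<le> u - 1" using False by linarith
    also have "\<dots> \<le> u - sin u" by simp
    finally show ?thesis .
  qed
  show "u - sin u \<le> 4 * u ^ 3 / (1 + u\<^sup>2)"
  proof (cases "u \<le> 1")
    case True
    have u2: "u\<^sup>2 \<le> 1" using True assms by (simp add: power_le_one)
    have "u ^ 5 = u ^ 3 * u\<^sup>2" by (simp add: flip: power_add)
    also have "\<dots> \<le> u ^ 3 * 1"
      using u2 assms by (intro mult_left_mono) auto
    finally have "u - sin u \<le> 4 * u ^ 3 / 2" using taylor assms by simp
    also have "\<dots> \<le> 4 * u ^ 3 / (1 + u\<^sup>2)"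
      using u2 assms pos by (intro divide_left_mono) auto
    finally show ?thesis .
  next
    case False
    have "u - sin u \<le> 2 * u" using sin_ge_minus_one[of u] False by linarith
    also have "\<dots> = 4 * u ^ 3 / (2 * u\<^sup>2)"
      using assms by (simp add: field_simps power2_eq_square power3_eq_cube)
    also have "\<dots> \<le> 4 * u ^ 3 / (1 + u\<^sup>2)"
    proof -
      have "1 \<le> u\<^sup>2" using False by (simp add: one_le_power)
      then show ?thesis using pos assms by (intro divide_left_mono) auto
    qed
    finally show ?thesis .
  qed
qed

lemma bump_kernel_minus: "bump_kernel w (- t) = bump_kernel w t"
proof -
  have "bump_kernel w (- t) = (- (2 * (w * t - sin (w * t)))) / (- (pi * w\<^sup>2 * t ^ 3))"
    by (simp add: bump_kernel_def)
  then show ?thesis unfolding minus_divide_divide bump_kernel_def .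
qed

text \<open>With \<open>u = w * t\<close> the kernel equals
  \<open>2 * w / (pi * u ^ 3) * (u - sin u)\<close>, so the bounds on \<open>u - sin u\<close> carry
  over; negative \<open>t\<close> follows by evenness. The origin is excluded because the default
  value \<open>0\<close> there violates the lower bound.\<close>

lemma bump_kernel_bounds:
  assumes "w > 0" "t \<noteq> 0"
  shows "w / (5 * pi * (1 + (w * t)\<^sup>2)) \<le> bump_kernel w t"
    and "bump_kernel w t \<le> 8 * w / (pi * (1 + (w * t)\<^sup>2))"
proof -
  have *: "w / (5 * pi * (1 + (w * t)\<^sup>2)) \<le> bump_kernel w t \<and>
      bump_kernel w t \<le> 8 * w / (pi * (1 + (w * t)\<^sup>2))" if "t > 0" for t
  proof -
    define u where "u = w * t"
    have u: "u > 0" and t: "t = u / w" using assms that by (auto simp: u_def)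
    have eq: "bump_kernel w t = 2 * w / (pi * u ^ 3) * (u - sin u)"
      using assms u unfolding bump_kernel_def t by (simp add: field_simps power2_eq_square power3_eq_cube)
    have c: "2 * w / (pi * u ^ 3) \<ge> 0" using assms u by simp
    have "w / (5 * pi * (1 + u\<^sup>2)) = 2 * w / (pi * u ^ 3) * (u ^ 3 / (10 * (1 + u\<^sup>2)))"
      using u by (simp add: divide_simps)
    also have "\<dots> \<le> bump_kernel w t"
      unfolding eq by (intro mult_left_mono c diff_sin_bounds u)
    finally have 1: "w / (5 * pi * (1 + u\<^sup>2)) \<le> bump_kernel w t" .
    have "bump_kernel w t \<le> 2 * w / (pi * u ^ 3) * (4 * u ^ 3 / (1 + u\<^sup>2))"
      unfolding eq by (intro mult_left_mono c diff_sin_bounds u)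
    also have "\<dots> = 8 * w / (pi * (1 + u\<^sup>2))"
      using u by (simp add: divide_simps)
    finally show ?thesis using 1 by (simp add: u_def)
  qed
  show "w / (5 * pi * (1 + (w * t)\<^sup>2)) \<le> bump_kernel w t"
    and "bump_kernel w t \<le> 8 * w / (pi * (1 + (w * t)\<^sup>2))"
    using *[of t] *[of "- t"] assms by (cases "t > 0"; simp add: bump_kernel_minus)+
qed

lemma bump_kernel_nonneg:
  assumes "w > 0"
  shows "bump_kernel w t \<ge> 0"
proof (cases "t = 0")
  case False
  have "0 \<le> w / (5 * pi * (1 + (w * t)\<^sup>2))" using assms by (simp add: add_nonneg_nonneg)
  also have "\<dots> \<le> bump_kernel w t" by (rule bump_kernel_bounds[OF assms False])
  finally show ?thesis .
qed (simp add: bump_kernel_def)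

text \<open>Away from the origin every kernel lies between positive multiples of
  \<open>1 / (1 + t\<^sup>2)\<close>, so any two have a bounded ratio. This lets the kernel of the
  central interval dominate those of all other intervals, whatever their lengths.\<close>

lemma bump_kernel_comparable:
  assumes "v > 0" "w > 0"
  obtains K where "K > 0" "\<And>t. bump_kernel w t \<le> K * bump_kernel v t"
proof -
  define L where "L = 1 + (v / w)\<^sup>2"
  have L: "L > 0" by (simp add: L_def add_pos_nonneg)
  \<comment> \<open>The quotient of the upper constant \<open>8 * w / pi\<close> by the lower
    constant \<open>v / (5 * pi)\<close>, times the factor \<open>L\<close> that compares
    \<open>1 + (v * t)\<^sup>2\<close> with \<open>1 + (w * t)\<^sup>2\<close>.\<close>
  define K where "K = 40 * w * L / v"
  have "bump_kernel w t \<le> K * bump_kernel v t" if "t \<noteq> 0" for t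
  proof -
    have p: "1 + (w * t)\<^sup>2 > 0" "1 + (v * t)\<^sup>2 > 0" by (simp_all add: add_pos_nonneg)
    have "1 + (v * t)\<^sup>2 \<le> L * (1 + (w * t)\<^sup>2)"
    proof -
      have "L * (1 + (w * t)\<^sup>2) = 1 + (w * t)\<^sup>2 + (v / w)\<^sup>2 + (v * t)\<^sup>2"
        using assms by (simp add: L_def field_simps)
      then show ?thesis by simp
    qed
    then have "8 * w * L / (pi * (L * (1 + (w * t)\<^sup>2))) \<le> 8 * w * L / (pi * (1 + (v * t)\<^sup>2))"
      using assms p L by (intro divide_left_mono mult_left_mono mult_pos_pos) auto
    also have "\<dots> = K * (v / (5 * pi * (1 + (v * t)\<^sup>2)))"
      using assms by (simp add: K_def)
    also have "8 * w * L / (pi * (L * (1 + (w * t)\<^sup>2))) = 8 * w / (pi * (1 + (w * t)\<^sup>2))"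
      using L by simp
    finally have "8 * w / (pi * (1 + (w * t)\<^sup>2)) \<le> K * (v / (5 * pi * (1 + (v * t)\<^sup>2)))" .
    also have "\<dots> \<le> K * bump_kernel v t"
      using assms L that by (intro mult_left_mono bump_kernel_bounds) (auto simp: K_def)
    finally show ?thesis using bump_kernel_bounds(2)[OF assms(2) that] by linarith
  qed
  \<comment> \<open>Both kernels take the default value \<open>0\<close> here, so the comparison
    holds at every point and not just almost everywhere.\<close>
  moreover have "bump_kernel w 0 \<le> K * bump_kernel v 0" by (simp add: bump_kernel_def)
  moreover have "K > 0" using assms L by (simp add: K_def)
  ultimately show ?thesis using that by metis
qed

lemma integrable_bump_kernel:
  assumes "w > 0"
  shows "integrable lborel (bump_kernel w)"
proof -
  have "integrable lborel (\<lambda>x::real. inverse (1 + x\<^sup>2))"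
    using integrable_inverse_1_plus_square by (simp add: set_integrable_def)
  then have "integrable lborel (\<lambda>x::real. inverse (1 + (0 + w * x)\<^sup>2))"
    by (subst lborel_integrable_real_affine_iff[of w _ 0]) (use assms in auto)
  then have "integrable lborel (\<lambda>x. 8 * w / pi * inverse (1 + (w * x)\<^sup>2))"
    by (intro integrable_mult_right) simp
  then show ?thesis
  proof (rule Bochner_Integration.integrable_bound)
    have "norm (bump_kernel w t) \<le> norm (8 * w / pi * inverse (1 + (w * t)\<^sup>2))" for t
    proof (cases "t = 0")
      case False
      have "norm (bump_kernel w t) \<le> 8 * w / pi * inverse (1 + (w * t)\<^sup>2)"
        using bump_kernel_nonneg[OF assms, of t] bump_kernel_bounds(2)[OF assms False]
        by (simp add: divide_inverse mult_ac)
      then show ?thesis using abs_ge_self order_trans unfolding real_norm_def by blast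
    qed (simp add: bump_kernel_def)
    then show "AE t in lborel. norm (bump_kernel w t) \<le> norm (8 * w / pi * inverse (1 + (w * t)\<^sup>2))"
      by simp
  qed simp
qed

section \<open>The squared triangle as a Fourier transform\<close>

lemma isCont_bump: "w > 0 \<Longrightarrow> isCont (bump w) x"
  unfolding bump_def by (intro continuous_intros) auto

lemma bump_nonzero_iff: "w > 0 \<Longrightarrow> bump w x \<noteq> 0 \<longleftrightarrow> \<bar>x\<bar> < w"
  by (auto simp: bump_def max_def field_simps)

lemma bump_nonneg: "bump w x \<ge> 0"
  by (simp add: bump_def)

lemma bump_le_1: "w > 0 \<Longrightarrow> bump w x \<le> 1"
  unfolding bump_def by (intro power_le_one) (auto simp: field_simps)

lemma measurable_bump [measurable]: "bump w \<in> borel_measurable borel"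
  unfolding bump_def by measurable

lemma integrable_bump:
  assumes "w > 0"
  shows "integrable lborel (bump w)"
proof (rule Bochner_Integration.integrable_bound)
  show "integrable lborel (indicator {-w..w} :: real \<Rightarrow> real)"
    by (rule integrable_real_indicator) (auto simp: emeasure_lborel_Icc_eq)
  show "bump w \<in> borel_measurable lborel"
    by simp
  show "AE x in lborel. norm (bump w x) \<le> norm (indicator {-w..w} x :: real)"
  proof (intro AE_I2)
    fix x
    show "norm (bump w x) \<le> norm (indicator {-w..w} x :: real)"
      using bump_le_1[OF assms, of x] bump_nonneg[of w x] bump_nonzero_iff[OF assms, of x]
      by (auto simp: indicator_def)
  qed
qed

lemma has_integral_bump_cos:
  assumes w: "w > 0" and t: "t \<noteq> 0"
  shows "has_bochner_integral lborel (\<lambda>x. bump w x * cos (t * x)) (2 * pi * bump_kernel w t)"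
proof -
  \<comment> \<open>An antiderivative of \<open>(1 - x / w)\<^sup>2 * cos (t * x)\<close>, found by
    integrating by parts twice. It handles \<open>{0..w}\<close>; reflection gives the other
    half.\<close>
  let ?F = "\<lambda>x. (1 - x / w)\<^sup>2 * sin (t * x) / t - 2 / w * (1 - x / w) * cos (t * x) / t\<^sup>2
      - 2 / w\<^sup>2 * sin (t * x) / t ^ 3"
  have F: "has_bochner_integral lborel (\<lambda>x. (1 - x / w)\<^sup>2 * cos (t * x) * indicator {0..w} x) (?F w - ?F 0)"
    using w t by (intro has_bochner_integral_FTC_Icc_real)
      (auto intro!: derivative_eq_intros continuous_intros simp: field_simps power2_eq_square power3_eq_cube)
  have val: "?F w - ?F 0 = pi * bump_kernel w t"
    using w t by (simp add: bump_kernel_def field_simps power2_eq_square power3_eq_cube)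
  have P: "has_bochner_integral lborel (\<lambda>x. bump w x * cos (t * x) * indicator {0..} x) (pi * bump_kernel w t)"
    using F unfolding val
    by (rule has_bochner_integral_cong[THEN iffD1, rotated -1])
      (use w in \<open>auto simp: indicator_def bump_def max_def field_simps\<close>)
  then have "has_bochner_integral lborel (\<lambda>x. bump w (0 + (-1) * x) * cos (t * (0 + (-1) * x)) * indicator {0..} (0 + (-1) * x))
      (pi * bump_kernel w t /\<^sub>R \<bar>-1\<bar>)"
    by (subst (asm) lborel_has_bochner_integral_real_affine_iff[of "-1" _ _ 0]) auto
  then have N: "has_bochner_integral lborel (\<lambda>x. bump w x * cos (t * x) * indicator {..0} x) (pi * bump_kernel w t)"
    by (simp add: bump_def indicator_def)
  have "has_bochner_integral lborel
      (\<lambda>x. bump w x * cos (t * x) * indicator {0..} x + bump w x * cos (t * x) * indicator {..0} x)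
      (pi * bump_kernel w t + pi * bump_kernel w t)"
    by (intro has_bochner_integral_add P N)
  \<comment> \<open>The two half-lines overlap at \<open>0\<close>, where the sum counts the
    integrand twice; one point is negligible.\<close>
  moreover have "AE x in lborel. x \<noteq> (0::real)" by (rule AE_lborel_singleton)
  then have "AE x in lborel. bump w x * cos (t * x) * indicator {0..} x
      + bump w x * cos (t * x) * indicator {..0} x = bump w x * cos (t * x)"
    by eventually_elim (auto simp: indicator_def)
  ultimately show ?thesis
    by (subst (asm) has_bochner_integral_cong_AE) (auto simp: mult.assoc)
qed

lemma fourier_minus: "fourier (\<lambda>t. q (- t)) x = fourier q (- x)"
  unfolding fourier_def by (subst lborel_integral_real_affine[where c="-1" and t=0]) auto

text \<open>Since \<open>bump w\<close> is even, its transform is the average of the values at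
  \<open>t\<close> and \<open>- t\<close>, which leaves only the cosine integral.\<close>

lemma fourier_bump:
  assumes w: "w > 0" and t: "t \<noteq> 0"
  shows "fourier (\<lambda>x. complex_of_real (bump w x)) t = 2 * pi * bump_kernel w t"
proof -
  let ?\<phi> = "\<lambda>x. complex_of_real (bump w x)"
  have int: "integrable lborel ?\<phi>"
    using integrable_bump[OF w] by (intro integrable_of_real)
  have "fourier ?\<phi> (- t) = fourier ?\<phi> t"
    by (subst fourier_minus[symmetric]) (simp add: bump_def)
  then have "fourier ?\<phi> t = (fourier ?\<phi> t + fourier ?\<phi> (- t)) / 2"
    by simp
  also have "fourier ?\<phi> t + fourier ?\<phi> (- t)
      = (CLINT x|lborel. iexp (t * x) * ?\<phi> x + iexp (- t * x) * ?\<phi> x)"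
    unfolding fourier_def
    by (rule Bochner_Integration.integral_add[symmetric]) (rule integrable_iexp_mult[OF int])+
  also have "\<dots> = (CLINT x|lborel. complex_of_real (2 * (bump w x * cos (t * x))))"
    by (intro Bochner_Integration.integral_cong refl)
       (simp add: complex_eq_iff Re_exp Im_exp)
  also have "\<dots> = 2 * (LINT x|lborel. bump w x * cos (t * x))"
    by (subst integral_complex_of_real) simp
  also have "(LINT x|lborel. bump w x * cos (t * x)) = 2 * pi * bump_kernel w t"
    using has_integral_bump_cos[OF w t] by (rule has_bochner_integral_integral_eq)
  finally show ?thesis by simp
qed

text \<open>Instead of integrating the kernel directly, the inversion theorem is applied to
  \<open>bump w\<close>, whose transform is already known off the origin and is integrable.\<close>

theorem fourier_bump_kernel:
  assumes w: "w > 0"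
  shows "fourier (\<lambda>t. complex_of_real (bump_kernel w t)) x = bump w x"
proof -
  let ?\<phi> = "\<lambda>x. complex_of_real (bump w x)"
  let ?K = "\<lambda>t. complex_of_real (bump_kernel w t)"
  have [measurable]: "(\<lambda>t. fourier ?\<phi> (- t)) \<in> borel_measurable lborel"
    unfolding fourier_def by measurable
  \<comment> \<open>At \<open>0\<close> the kernel has its default value rather than that of the
    transform, so the identity is used only almost everywhere.\<close>
  have "AE t in lborel. t \<noteq> (0::real)" by (rule AE_lborel_singleton)
  then have ae: "AE t in lborel. 2 * pi * ?K t = fourier ?\<phi> (- t)"
    by eventually_elim (simp add: fourier_bump[OF w] bump_kernel_minus)
  have K: "integrable lborel (\<lambda>t. 2 * pi * ?K t)"
    using integrable_bump_kernel[OF w] by (intro integrable_mult_right integrable_of_real)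
  have "fourier (\<lambda>t. 2 * pi * ?K t) x = fourier (\<lambda>t. fourier ?\<phi> (- t)) x"
    unfolding fourier_def[of "\<lambda>t. 2 * pi * ?K t"] fourier_def[of "\<lambda>t. fourier ?\<phi> (- t)"]
  proof (rule integral_cong_AE)
    show "AE t in lborel. iexp (x * t) * (2 * pi * ?K t) = iexp (x * t) * fourier ?\<phi> (- t)"
      using ae by eventually_elim simp
  qed simp_all
  also have "\<dots> = 2 * pi * ?\<phi> x"
  proof (rule fourier_inversion[where B=1])
    show "integrable lborel ?\<phi>" using integrable_bump[OF w] by (intro integrable_of_real)
    show "integrable lborel (\<lambda>t. fourier ?\<phi> (- t))"
      by (rule integrable_cong_AE_imp[OF K _ ae]) simp
    show "norm (?\<phi> y) \<le> 1" for y using bump_nonneg[of w y] bump_le_1[OF w] by simp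
    show "isCont ?\<phi> x" by (intro continuous_intros isCont_bump w)
  qed
  also have "fourier (\<lambda>t. 2 * pi * ?K t) x = 2 * pi * fourier ?K x"
    unfolding fourier_def by (subst integral_mult_right_zero[symmetric]) (simp add: mult_ac)
  finally show ?thesis by simp
qed

section \<open>Dominated spectra with prescribed interval support\<close>

lemma fourier_shifted_bump_kernel:
  assumes "w > 0"
  shows "fourier (\<lambda>t. complex_of_real r * iexp (- c * t) * bump_kernel w t) x = r * bump w (x - c)"
proof -
  have "fourier (\<lambda>t. complex_of_real r * iexp (- c * t) * bump_kernel w t) x
      = (CLINT t|lborel. complex_of_real r * (iexp ((x - c) * t) * bump_kernel w t))"
    unfolding fourier_def
    by (intro Bochner_Integration.integral_cong refl) (simp add: algebra_simps flip: exp_add)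
  also have "\<dots> = r * fourier (\<lambda>t. complex_of_real (bump_kernel w t)) (x - c)"
    unfolding fourier_def by (subst integral_mult_right_zero) simp
  finally show ?thesis by (simp add: fourier_bump_kernel[OF assms])
qed

text \<open>A squared triangle of half-width \<open>(b - a) / 2\<close> is translated to the
  midpoint. Translation multiplies the spectrum by a unimodular factor, so division by the
  comparison constant \<open>K\<close> suffices for the domination.\<close>

lemma exists_fourier_support_bounded:
  assumes v: "v > 0" and ab: "a < b"
  shows "\<exists>q \<in> borel_measurable borel. (\<forall>t. norm (q t) \<le> bump_kernel v t) \<and>
    {x. fourier q x \<noteq> 0} = {a<..<b}"
proof -
  define w c where "w = (b - a) / 2" and "c = (a + b) / 2"
  have w: "w > 0" using ab by (simp add: w_def)
  obtain K where K: "K > 0" "\<And>t. bump_kernel w t \<le> K * bump_kernel v t"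
    using bump_kernel_comparable[OF v w] by blast
  let ?q = "\<lambda>t. complex_of_real (1 / K) * iexp (- c * t) * bump_kernel w t"
  have "norm (?q t) \<le> bump_kernel v t" for t
    using K bump_kernel_nonneg[OF w, of t] by (simp add: norm_mult norm_divide field_simps)
  moreover have "{x. fourier ?q x \<noteq> 0} = {a<..<b}"
    unfolding fourier_shifted_bump_kernel[OF w] of_real_mult[symmetric] of_real_eq_0_iff
    using K(1) bump_nonzero_iff[OF w] by (auto simp: w_def c_def abs_if field_simps split: if_splits)
  ultimately show ?thesis by (intro bexI[of _ ?q]) auto
qed

text \<open>Overlapping squared triangles of half-width \<open>1\<close>, centred at
  \<open>a + 1 + m\<close>, together cover exactly the half-line. Positive coefficients rule out
  cancellation, and geometric decay keeps the summed spectra below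
  \<open>bump_kernel v\<close>.\<close>

lemma exists_fourier_support_unbounded:
  assumes v: "v > 0"
  shows "\<exists>q \<in> borel_measurable borel. (\<forall>t. norm (q t) \<le> bump_kernel v t) \<and>
    {x. fourier q x \<noteq> 0} = {a<..}"
proof -
  obtain K where K: "K > 0" "\<And>t. bump_kernel 1 t \<le> K * bump_kernel v t"
    using bump_kernel_comparable[OF v zero_less_one] by blast
  define c where "c m = a + 1 + real m" for m
  \<comment> \<open>The factor \<open>1 / K\<close> gives domination of each term; the powers of
    \<open>1 / 2\<close> start at exponent \<open>1\<close> so that they sum to exactly
    \<open>1\<close>.\<close>
  define r where "r m = (1 / 2) ^ Suc m / K" for m
  have r: "r m > 0" for m using K(1) by (simp add: r_def)
  define p where "p m t = complex_of_real (r m) * iexp (- c m * t) * bump_kernel 1 t" for m t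
  have [measurable]: "p m \<in> borel_measurable borel" for m unfolding p_def by measurable
  have half: "(\<lambda>m. (1 / 2 :: real) ^ Suc m) sums 1" by (rule power_half_series)
  have norm_p: "norm (p m t) \<le> (1 / 2) ^ Suc m * bump_kernel v t" for m t
  proof -
    have "norm (p m t) = r m * bump_kernel 1 t"
      using r[of m] bump_kernel_nonneg[of 1 t] by (simp add: p_def norm_mult)
    also have "\<dots> \<le> r m * (K * bump_kernel v t)"
      using r[of m] by (intro mult_left_mono K) auto
    finally show ?thesis using K(1) by (simp add: r_def)
  qed
  have sum_bound: "(\<lambda>m. (1 / 2) ^ Suc m * bump_kernel v t) sums bump_kernel v t" for t
    using sums_mult2[OF half, of "bump_kernel v t"] by simp
  have summable_norm_p: "summable (\<lambda>m. norm (p m t))" for t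
    by (rule summable_comparison_test'[OF sums_summable[OF sum_bound[of t]], of 0])
      (use norm_p in \<open>simp del: power_Suc\<close>)
  define q where "q t = (\<Sum>m. p m t)" for t
  have [measurable]: "q \<in> borel_measurable borel" unfolding q_def by measurable
  have norm_q: "norm (q t) \<le> bump_kernel v t" for t
  proof -
    have "norm (q t) \<le> (\<Sum>m. norm (p m t))"
      unfolding q_def by (rule summable_norm[OF summable_norm_p])
    also have "\<dots> \<le> (\<Sum>m. (1 / 2) ^ Suc m * bump_kernel v t)"
      by (rule suminf_le[OF norm_p summable_norm_p sums_summable[OF sum_bound]])
    finally show ?thesis using sums_unique[OF sum_bound[of t]] by simp
  qed
  have int_v: "integrable lborel (bump_kernel v)" by (rule integrable_bump_kernel[OF v])
  have int_p: "integrable lborel (\<lambda>t. iexp (x * t) * p m t)" for x m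
  proof (rule Bochner_Integration.integrable_bound)
    show "integrable lborel (\<lambda>t. (1 / 2) ^ Suc m * bump_kernel v t)"
      by (intro integrable_mult_right int_v)
    have "norm (iexp (x * t) * p m t) \<le> norm ((1 / 2) ^ Suc m * bump_kernel v t)" for t
    proof -
      have "norm (iexp (x * t) * p m t) = norm (p m t)" by (simp add: norm_mult)
      also have "\<dots> \<le> (1 / 2) ^ Suc m * bump_kernel v t" by (rule norm_p)
      also have "\<dots> \<le> norm ((1 / 2) ^ Suc m * bump_kernel v t)" by simp
      finally show ?thesis .
    qed
    then show "AE t in lborel. norm (iexp (x * t) * p m t) \<le> norm ((1 / 2) ^ Suc m * bump_kernel v t)"
      by simp
  qed simp
  have fourier_p: "fourier (p m) x = complex_of_real (r m * bump 1 (x - c m))" for m x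
    unfolding p_def by (rule fourier_shifted_bump_kernel) simp
  have fourier_q: "fourier q x = (\<Sum>m. complex_of_real (r m * bump 1 (x - c m)))" for x
  proof -
    have "fourier q x = (CLINT t|lborel. \<Sum>m. iexp (x * t) * p m t)"
      unfolding fourier_def q_def
      by (intro Bochner_Integration.integral_cong refl suminf_mult[symmetric]
          summable_norm_cancel[OF summable_norm_p])
    \<comment> \<open>The integrals of the norms are bounded by a geometric series times the
      integral of \<open>bump_kernel v\<close>, which permits the exchange.\<close>
    also have "\<dots> = (\<Sum>m. CLINT t|lborel. iexp (x * t) * p m t)"
    proof (rule integral_suminf[OF int_p])
      show "AE t in lborel. summable (\<lambda>m. norm (iexp (x * t) * p m t))"
        using summable_norm_p by (simp add: norm_mult)
      show "summable (\<lambda>m. LINT t|lborel. norm (iexp (x * t) * p m t))"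
      proof (rule summable_comparison_test'[where N=0])
        show "summable (\<lambda>m. (1 / 2) ^ Suc m * (LINT t|lborel. bump_kernel v t))"
          by (rule summable_mult2[OF sums_summable[OF half]])
        fix m
        have "(LINT t|lborel. norm (iexp (x * t) * p m t))
            \<le> (LINT t|lborel. (1 / 2) ^ Suc m * bump_kernel v t)"
          by (intro integral_mono integrable_norm[OF int_p] integrable_mult_right int_v)
             (use norm_p in \<open>simp add: norm_mult\<close>)
        then show "norm (LINT t|lborel. norm (iexp (x * t) * p m t))
            \<le> (1 / 2) ^ Suc m * (LINT t|lborel. bump_kernel v t)"
          by simp
      qed
    qed
    finally show ?thesis by (simp only: fourier_p flip: fourier_def)
  qed
  have "fourier q x \<noteq> 0 \<longleftrightarrow> x > a" for x
  proof -
    have summ: "summable (\<lambda>m. r m * bump 1 (x - c m))"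
    proof (rule summable_comparison_test'[where N=0])
      show "summable (\<lambda>m. (1 / 2) ^ Suc m / K)" by (rule summable_divide[OF sums_summable[OF half]])
      show "norm (r m * bump 1 (x - c m)) \<le> (1 / 2) ^ Suc m / K" for m
        using r[of m] bump_le_1[of 1 "x - c m"] bump_nonneg[of 1 "x - c m"]
        unfolding r_def[symmetric] by (simp add: mult_left_le)
    qed
    have "fourier q x = complex_of_real (\<Sum>m. r m * bump 1 (x - c m))"
      unfolding fourier_q by (rule suminf_of_real[OF summ, symmetric])
    then have "fourier q x = 0 \<longleftrightarrow> (\<Sum>m. r m * bump 1 (x - c m)) = 0"
      by (simp only: of_real_eq_0_iff)
    \<comment> \<open>All terms are nonnegative, so the sum vanishes only if every term
      does.\<close>
    also have "\<dots> \<longleftrightarrow> (\<forall>m. r m * bump 1 (x - c m) = 0)"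
      using summ by (rule suminf_eq_zero_iff) (simp add: less_imp_le[OF r] bump_nonneg)
    finally have "fourier q x \<noteq> 0 \<longleftrightarrow> (\<exists>m. r m * bump 1 (x - c m) \<noteq> 0)"
      by blast
    also have "\<dots> \<longleftrightarrow> (\<exists>m. \<bar>x - c m\<bar> < 1)"
      using bump_nonzero_iff[of 1] r by (simp add: less_imp_neq[OF r, symmetric])
    also have "\<dots> \<longleftrightarrow> x > a"
    proof
      assume "x > a"
      \<comment> \<open>For this index the centre is \<open>a\<close> plus the ceiling of
        \<open>x - a\<close>, which exceeds \<open>x\<close> by less than \<open>1\<close>. As
        \<open>x > a\<close>, the ceiling is at least \<open>1\<close> and \<open>nat\<close>
        truncates nothing.\<close>
      then have "\<bar>x - c (nat (\<lceil>x - a\<rceil> - 1))\<bar> < 1"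
        by (simp add: c_def abs_if) linarith
      then show "\<exists>m. \<bar>x - c m\<bar> < 1" ..
    qed (auto simp: c_def abs_if split: if_splits)
    finally show ?thesis .
  qed
  then show ?thesis using norm_q by (intro bexI[of _ q]) auto
qed

lemma exists_fourier_support:
  assumes "v > 0" "ereal a < b"
  obtains q where "q \<in> borel_measurable borel" "\<And>t. norm (q t) \<le> bump_kernel v t"
    "{x. fourier q x \<noteq> 0} = einterval a b"
proof (cases b)
  case (real b')
  then have "einterval a b = {a<..<b'}" by (auto simp: einterval_def)
  then show ?thesis using exists_fourier_support_bounded[OF assms(1), of a b'] assms real that by auto
next
  case PInf
  then have "einterval a b = {a<..}" by (auto simp: einterval_def)
  then show ?thesis using exists_fourier_support_unbounded[OF assms(1), of a] that by auto
qed (use assms in auto)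

subsection \<open>Characteristic functions with prescribed phases\<close>

lemma fourier_add:
  assumes "integrable lborel p" "integrable lborel q"
  shows "fourier (\<lambda>t. p t + q t) x = fourier p x + fourier q x"
  unfolding fourier_def distrib_left
  by (intro Bochner_Integration.integral_add integrable_iexp_mult assms)

lemma fourier_mult_left: "fourier (\<lambda>t. c * q t) x = c * fourier q x"
  unfolding fourier_def by (subst integral_mult_right_zero[symmetric]) (simp add: mult_ac)

lemma fourier_sum:
  assumes "\<And>j. j \<in> J \<Longrightarrow> integrable lborel (q j)"
  shows "fourier (\<lambda>t. \<Sum>j\<in>J. q j t) x = (\<Sum>j\<in>J. fourier (q j) x)"
  unfolding fourier_def sum_distrib_left
  by (intro Bochner_Integration.integral_sum integrable_iexp_mult assms)

lemma fourier_cnj: "fourier (\<lambda>t. cnj (q t)) x = cnj (fourier q (- x))"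
  unfolding fourier_def Bochner_Integration.integral_cnj[symmetric] by (simp add: exp_cnj)

section \<open>Membership in \<open>CH\<close> and Hermitian symmetry\<close>

lemma CH_isCont: "f \<in> CH \<Longrightarrow> isCont f x"
  by (auto simp: CH_def real_distribution.isCont_char)

lemma CH_zero: "f \<in> CH \<Longrightarrow> f 0 = 1"
  by (auto simp: CH_def real_distribution.char_zero)

lemma CH_minus:
  assumes "f \<in> CH"
  shows "f (- x) = cnj (f x)"
proof -
  obtain M where f: "f = char M" using assms by (auto simp: CH_def)
  show ?thesis
    unfolding f char_def Bochner_Integration.integral_cnj[symmetric]
    by (simp add: exp_cnj del: Bochner_Integration.integral_cnj)
qed

text \<open>The value of the transform at \<open>0\<close> is the total mass, so the assumption
  there is exactly the normalisation of a probability density.\<close>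

lemma fourier_density_in_CH:
  fixes P :: "real \<Rightarrow> real"
  assumes P: "integrable lborel P" "\<And>t. P t \<ge> 0"
    and one: "fourier (\<lambda>t. complex_of_real (P t)) 0 = 1"
  shows "fourier (\<lambda>t. complex_of_real (P t)) \<in> CH"
proof -
  note [measurable] = borel_measurable_integrable[OF P(1)]
  let ?M = "density lborel P"
  have "complex_of_real (LINT t|lborel. P t) = 1"
    using one by (simp add: fourier_def)
  then have "(LINT t|lborel. P t) = 1"
    using of_real_eq_1_iff by blast
  then have "prob_space ?M"
    using P by (intro prob_spaceI) (simp add: emeasure_density nn_integral_eq_integral)
  then have "real_distribution ?M"
    by (simp add: real_distribution_def real_distribution_axioms_def)
  moreover have "fourier (\<lambda>t. complex_of_real (P t)) = char ?M"
    unfolding fourier_def char_def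
    by (intro ext, subst integral_density) (use P in \<open>auto simp: scaleR_conv_of_real mult.commute\<close>)
  ultimately show ?thesis unfolding CH_def by blast
qed

text \<open>The \<open>q j\<close> are dominated by the positive density \<open>P\<close>, so that a small multiple of
  their sum may be added to \<open>P\<close> after multiplying each \<open>q j\<close> by an arbitrary unimodular number.\<close>

locale dominated_spectrum =
  fixes P :: "real \<Rightarrow> real" and J :: "'i set" and q :: "'i \<Rightarrow> real \<Rightarrow> complex"
    and S\<^sub>0 :: "real set" and S :: "'i \<Rightarrow> real set"
  assumes finite_J: "finite J"
    and P_integrable: "integrable lborel P" and P_nonneg: "\<And>t. P t \<ge> 0"
    and P_one: "fourier (\<lambda>t. complex_of_real (P t)) 0 = 1"
    and P_support: "{x. fourier (\<lambda>t. complex_of_real (P t)) x \<noteq> 0} = S\<^sub>0"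
    and q_measurable: "\<And>j. j \<in> J \<Longrightarrow> q j \<in> borel_measurable borel"
    and q_le: "\<And>j t. j \<in> J \<Longrightarrow> norm (q j t) \<le> P t"
    and q_support: "\<And>j. j \<in> J \<Longrightarrow> {x. fourier (q j) x \<noteq> 0} = S j"
    and connected_S\<^sub>0: "connected S\<^sub>0" and connected_S: "\<And>j. j \<in> J \<Longrightarrow> connected (S j)"
    and S_pos: "\<And>j x. j \<in> J \<Longrightarrow> x \<in> S j \<Longrightarrow> x > 0"
    and S_nonempty: "\<And>j. j \<in> J \<Longrightarrow> S j \<noteq> {}"
    and S_disjoint: "\<And>i j x. i \<in> J \<Longrightarrow> j \<in> J \<Longrightarrow> x \<in> S i \<Longrightarrow> x \<in> S j \<Longrightarrow> i = j"
    and S_disjoint_S\<^sub>0: "\<And>j x. j \<in> J \<Longrightarrow> x \<in> S j \<Longrightarrow> x \<notin> S\<^sub>0"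
begin

text \<open>Each of the \<open>card J\<close> perturbing terms is at least \<open>- P t\<close>, so
  this factor keeps the total density nonnegative. Adding \<open>1\<close> in the denominator keeps
  the weight positive when \<open>J\<close> is empty.\<close>

definition weight :: real where "weight = 1 / (real (card J) + 1)"

text \<open>The real part makes the density real. On the transform side it pairs each piece with its
  conjugated mirror image, as Hermitian symmetry demands.\<close>

definition twisted_density :: "('i \<Rightarrow> complex) \<Rightarrow> real \<Rightarrow> real" where
  "twisted_density e t = P t + weight * (\<Sum>j\<in>J. Re (e j * q j t))"

definition twisted :: "('i \<Rightarrow> complex) \<Rightarrow> real \<Rightarrow> complex" where
  "twisted e = fourier (\<lambda>t. complex_of_real (twisted_density e t))"

lemma weight_pos: "weight > 0" by (simp add: weight_def add_nonneg_pos)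

lemma q_integrable: "j \<in> J \<Longrightarrow> integrable lborel (q j)"
  using P_integrable
  by (rule Bochner_Integration.integrable_bound) (use q_measurable q_le P_nonneg in auto)

lemma twisted_density_integrable: "integrable lborel (twisted_density e)"
  unfolding twisted_density_def
  by (intro Bochner_Integration.integrable_add P_integrable integrable_mult_right
      Bochner_Integration.integrable_sum integrable_Re q_integrable)

lemma twisted_density_nonneg:
  assumes "\<And>j. j \<in> J \<Longrightarrow> norm (e j) \<le> 1"
  shows "twisted_density e t \<ge> 0"
proof -
  have "- (weight * (\<Sum>j\<in>J. Re (e j * q j t))) = weight * (\<Sum>j\<in>J. - Re (e j * q j t))"
    by (simp only: sum_negf mult_minus_right)
  also have "\<dots> \<le> weight * (\<Sum>j\<in>J. P t)"
  proof (intro mult_left_mono sum_mono)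
    fix j assume j: "j \<in> J"
    have "- Re (e j * q j t) \<le> norm (e j * q j t)"
      using abs_Re_le_cmod[of "e j * q j t"] by linarith
    also have "\<dots> \<le> 1 * P t"
      unfolding norm_mult by (intro mult_mono assms q_le j) auto
    finally show "- Re (e j * q j t) \<le> P t" by simp
  qed (use weight_pos in simp)
  also have "\<dots> \<le> 1 * P t"
    unfolding sum_constant mult.assoc[symmetric]
    by (intro mult_right_mono P_nonneg) (simp add: weight_def)
  finally show ?thesis unfolding twisted_density_def by linarith
qed

text \<open>Write the real part as half the sum of a number and its conjugate; conjugating a
  spectrum reflects and conjugates its transform. Thus \<open>e j\<close> acts on \<open>S j\<close>
  and its conjugate on the mirror image.\<close>

lemma twisted_eq:
  "twisted e x = fourier (\<lambda>t. complex_of_real (P t)) x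
    + weight / 2 * (\<Sum>j\<in>J. e j * fourier (q j) x + cnj (e j * fourier (q j) (- x)))"
proof -
  have P: "integrable lborel (\<lambda>t. complex_of_real (P t))"
    by (intro integrable_of_real P_integrable)
  have eq: "integrable lborel (\<lambda>t. e j * q j t)" if "j \<in> J" for j
    by (intro integrable_mult_right q_integrable that)
  have cq: "integrable lborel (\<lambda>t. cnj (e j * q j t))" if "j \<in> J" for j
    by (rule integrable_cnj[OF eq[OF that]])
  have Re_eq: "complex_of_real (Re z) = 1 / 2 * (z + cnj z)" for z
    by (simp add: complex_add_cnj)
  have "(\<lambda>t. complex_of_real (twisted_density e t))
      = (\<lambda>t. complex_of_real (P t) + weight / 2 * (\<Sum>j\<in>J. e j * q j t + cnj (e j * q j t)))"
    unfolding twisted_density_def of_real_add of_real_mult of_real_sum Re_eq sum_distrib_left[symmetric]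
    by simp
  then have "twisted e x = fourier (\<lambda>t. complex_of_real (P t)) x
    + fourier (\<lambda>t. weight / 2 * (\<Sum>j\<in>J. e j * q j t + cnj (e j * q j t))) x"
    unfolding twisted_def
    by (simp only:, intro fourier_add P integrable_mult_right Bochner_Integration.integrable_sum
      Bochner_Integration.integrable_add eq cq)
  also have "fourier (\<lambda>t. weight / 2 * (\<Sum>j\<in>J. e j * q j t + cnj (e j * q j t))) x
    = weight / 2 * (\<Sum>j\<in>J. fourier (\<lambda>t. e j * q j t + cnj (e j * q j t)) x)"
    unfolding fourier_mult_left
    by (intro arg_cong2[where f="(*)"] refl fourier_sum Bochner_Integration.integrable_add eq cq)
  also have "(\<Sum>j\<in>J. fourier (\<lambda>t. e j * q j t + cnj (e j * q j t)) x)
    = (\<Sum>j\<in>J. e j * fourier (q j) x + cnj (e j * fourier (q j) (- x)))"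
    by (intro sum.cong refl) (simp only: fourier_add[OF eq cq] fourier_cnj fourier_mult_left)
  finally show ?thesis .
qed

section \<open>Values of the twisted functions on the pieces of the support\<close>

lemma fourier_P_zero_iff: "fourier (\<lambda>t. complex_of_real (P t)) x = 0 \<longleftrightarrow> x \<notin> S\<^sub>0"
  using P_support by blast

lemma fourier_q_zero_iff: "j \<in> J \<Longrightarrow> fourier (q j) x = 0 \<longleftrightarrow> x \<notin> S j"
  using q_support by blast

text \<open>Every \<open>S j\<close> lies in the positive half-line, so the reflected pieces vanish
  for \<open>x \<ge> 0\<close>.\<close>

lemma twisted_nonneg_arg:
  assumes "x \<ge> 0"
  shows "twisted e x = fourier (\<lambda>t. complex_of_real (P t)) x + weight / 2 * (\<Sum>j\<in>J. e j * fourier (q j) x)"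
proof -
  have "fourier (q j) (- x) = 0" if "j \<in> J" for j
    using that assms S_pos[OF that, of "- x"] by (auto simp: fourier_q_zero_iff)
  then show ?thesis unfolding twisted_eq by simp
qed

lemma twisted_on_S\<^sub>0:
  assumes "x \<ge> 0" "x \<in> S\<^sub>0"
  shows "twisted e x = fourier (\<lambda>t. complex_of_real (P t)) x"
proof -
  have "fourier (q j) x = 0" if "j \<in> J" for j
    using S_disjoint_S\<^sub>0 that assms by (auto simp: fourier_q_zero_iff)
  then show ?thesis using assms by (simp add: twisted_nonneg_arg)
qed

lemma twisted_on_S:
  assumes "i \<in> J" "x \<in> S i"
  shows "twisted e x = weight / 2 * (e i * fourier (q i) x)"
proof -
  have "(\<Sum>j\<in>J. e j * fourier (q j) x) = (\<Sum>j\<in>J. if j = i then e j * fourier (q j) x else 0)"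
  proof (intro sum.cong refl)
    fix j assume "j \<in> J"
    then show "e j * fourier (q j) x = (if j = i then e j * fourier (q j) x else 0)"
      using S_disjoint[OF assms(1) \<open>j \<in> J\<close> assms(2)] by (auto simp: fourier_q_zero_iff)
  qed
  also have "\<dots> = e i * fourier (q i) x"
    using finite_J assms by simp
  finally have "(\<Sum>j\<in>J. e j * fourier (q j) x) = e i * fourier (q i) x" .
  moreover have "x \<ge> 0" using S_pos[OF assms] by simp
  moreover have "fourier (\<lambda>t. complex_of_real (P t)) x = 0"
    using S_disjoint_S\<^sub>0[OF assms] by (simp add: fourier_P_zero_iff)
  ultimately show ?thesis by (simp add: twisted_nonneg_arg)
qed

lemma twisted_off_support:
  assumes "x \<ge> 0" "x \<notin> S\<^sub>0" "\<And>j. j \<in> J \<Longrightarrow> x \<notin> S j"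
  shows "twisted e x = 0"
proof -
  have "fourier (\<lambda>t. complex_of_real (P t)) x = 0" using assms by (simp add: fourier_P_zero_iff)
  moreover have "fourier (q j) x = 0" if "j \<in> J" for j
    using assms that by (simp add: fourier_q_zero_iff)
  ultimately show ?thesis using assms(1) by (simp add: twisted_nonneg_arg)
qed

lemma zero_in_S\<^sub>0: "0 \<in> S\<^sub>0"
  using P_one fourier_P_zero_iff[of 0] by auto

lemma twisted_in_CH:
  assumes "\<And>j. j \<in> J \<Longrightarrow> norm (e j) \<le> 1"
  shows "twisted e \<in> CH"
proof -
  have "twisted e 0 = 1"
    using twisted_on_S\<^sub>0[OF order_refl zero_in_S\<^sub>0] P_one by simp
  then show ?thesis
    using fourier_density_in_CH[OF twisted_density_integrable twisted_density_nonneg[OF assms]]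
    by (simp add: twisted_def)
qed

text \<open>Hermitian symmetry determines a characteristic function by its values on the nonnegative
  half-line.\<close>

lemma twisted_eqI:
  assumes "g \<in> CH" "\<And>j. j \<in> J \<Longrightarrow> norm (e j) \<le> 1" "\<And>x. x \<ge> 0 \<Longrightarrow> g x = twisted e x"
  shows "g = twisted e"
proof
  fix x
  have "twisted e \<in> CH" by (rule twisted_in_CH[OF assms(2)])
  then show "g x = twisted e x"
    using assms(3)[of x] assms(3)[of "- x"] CH_minus[OF assms(1), of x] CH_minus[of "twisted e" x]
    by (cases "x \<ge> 0") auto
qed

abbreviation base :: "real \<Rightarrow> complex" where "base \<equiv> twisted (\<lambda>_. 1)"

lemma base_in_CH: "base \<in> CH"
  by (rule twisted_in_CH) simp

lemma nonzero_set_base: "nonzero_set base = S\<^sub>0 \<union> (\<Union>j\<in>J. S j \<union> uminus ` S j)"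
proof -
  have sym: "base (- x) = 0 \<longleftrightarrow> base x = 0" for x
    unfolding CH_minus[OF base_in_CH] by (rule complex_cnj_zero_iff)
  \<comment> \<open>The density \<open>P\<close> is real, so its transform is Hermitian and has a
    symmetric support.\<close>
  have sym0: "- x \<in> S\<^sub>0 \<longleftrightarrow> x \<in> S\<^sub>0" for x
  proof -
    have "fourier (\<lambda>t. complex_of_real (P t)) x = cnj (fourier (\<lambda>t. complex_of_real (P t)) (- x))"
      using fourier_cnj[of "\<lambda>t. complex_of_real (P t)" x] by (simp only: complex_cnj_complex_of_real)
    then show ?thesis by (metis complex_cnj_zero_iff fourier_P_zero_iff)
  qed
  have pos: "base x \<noteq> 0 \<longleftrightarrow> x \<in> S\<^sub>0 \<or> (\<exists>j\<in>J. x \<in> S j)" if "x \<ge> 0" for x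
  proof -
    consider "x \<in> S\<^sub>0" | j where "j \<in> J" "x \<in> S j" | "x \<notin> S\<^sub>0" "\<And>j. j \<in> J \<Longrightarrow> x \<notin> S j"
      by blast
    then show ?thesis
    proof cases
      case 1
      then show ?thesis using that by (simp add: twisted_on_S\<^sub>0 fourier_P_zero_iff)
    next
      case 2
      then have "base x \<noteq> 0" using weight_pos by (simp add: twisted_on_S fourier_q_zero_iff)
      then show ?thesis using 2 by blast
    next
      case 3
      then have "base x = 0" using that by (intro twisted_off_support) auto
      then show ?thesis using 3 by blast
    qed
  qed
  have "base x \<noteq> 0 \<longleftrightarrow> x \<in> S\<^sub>0 \<or> (\<exists>j\<in>J. x \<in> S j \<or> - x \<in> S j)" for x
  proof (cases "x \<ge> 0")
    case True
    then have "- x \<notin> S j" if "j \<in> J" for j using S_pos[OF that, of "- x"] by auto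
    then show ?thesis using pos[OF True] by blast
  next
    case False
    then have "x \<notin> S j" if "j \<in> J" for j using S_pos[OF that, of x] by auto
    then show ?thesis using pos[of "- x"] False sym[of x] sym0[of x] by simp
  qed
  moreover have "x \<in> uminus ` A \<longleftrightarrow> - x \<in> A" for x :: real and A
    by (auto simp: image_iff intro: bexI[of _ "- x"])
  ultimately show ?thesis unfolding nonzero_set_def by auto
qed

text \<open>For \<open>x \<ge> 0\<close> at most one piece is nonzero, so at most one factor
  \<open>e j\<close> is present, and its \<open>n\<close>-th power is \<open>1\<close>. Hermitian
  symmetry transfers the identity to negative arguments.\<close>

lemma power_twisted:
  assumes "n > 0" "\<And>j. j \<in> J \<Longrightarrow> e j ^ n = 1"
  shows "twisted e x ^ n = base x ^ n"
proof -
  have nonneg: "twisted e x ^ n = base x ^ n" if "x \<ge> 0" for x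
  proof -
    consider "x \<in> S\<^sub>0" | j where "j \<in> J" "x \<in> S j" | "x \<notin> S\<^sub>0" "\<And>j. j \<in> J \<Longrightarrow> x \<notin> S j"
      by blast
    then show ?thesis
    proof cases
      case 1
      then show ?thesis using that by (simp add: twisted_on_S\<^sub>0)
    next
      case 2
      then show ?thesis using assms by (simp add: twisted_on_S power_mult_distrib power_divide)
    next
      case 3
      then show ?thesis using that by (simp add: twisted_off_support)
    qed
  qed
  have norm_e: "norm (e j) \<le> 1" if "j \<in> J" for j
    using power_eq_1_iff[OF assms(2)[OF that]] assms(1) by auto
  have "twisted e \<in> CH" by (rule twisted_in_CH[OF norm_e])
  then show ?thesis
    using nonneg[of x] nonneg[of "- x"] CH_minus[OF base_in_CH, of x] CH_minus[of "twisted e" x]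
    by (cases "x \<ge> 0") (auto simp flip: complex_cnj_power)
qed

section \<open>Classification of the functions with the same power\<close>

lemma twisted_inj:
  assumes "twisted d = twisted e" "j \<in> J"
  shows "d j = e j"
proof -
  obtain x where x: "x \<in> S j" using S_nonempty[OF assms(2)] by blast
  then have "weight / 2 * (d j * fourier (q j) x) = weight / 2 * (e j * fourier (q j) x)"
    using assms by (metis twisted_on_S)
  then show ?thesis using weight_pos x fourier_q_zero_iff[OF assms(2), of x] by auto
qed

text \<open>On \<open>A\<close> the quotient of \<open>g\<close> by \<open>base\<close> is
  continuous and takes values in the finite set of \<open>n\<close>-th roots of unity; on a
  connected set such a function is constant.\<close>

lemma root_quotient_constant:
  assumes n: "n > 0" and g: "g \<in> C_roots n base" and A: "connected A" "A \<subseteq> nonzero_set base"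
  obtains z where "z ^ n = 1" "\<And>x. x \<in> A \<Longrightarrow> g x = z * base x"
proof -
  let ?r = "\<lambda>x. g x / base x"
  have g': "g \<in> CH" "\<And>x. g x ^ n = base x ^ n" using g by (auto simp: C_roots_def)
  have nz: "base x \<noteq> 0" if "x \<in> A" for x using A that by (auto simp: nonzero_set_def)
  have root: "?r x ^ n = 1" if "x \<in> A" for x
    using nz[OF that] g'(2)[of x] by (simp add: power_divide)
  have "continuous_on A ?r"
    using CH_isCont[OF g'(1)] CH_isCont[OF base_in_CH] nz
    by (intro continuous_on_divide continuous_at_imp_continuous_on) auto
  moreover have "finite (?r ` A)"
    by (rule finite_subset[OF _ finite_roots_unity[of n]]) (use root n in auto)
  ultimately have "?r constant_on A" by (rule continuous_finite_range_constant[OF A(1)])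
  then obtain z where z: "\<And>x. x \<in> A \<Longrightarrow> ?r x = z" by (auto simp: constant_on_def)
  show ?thesis
  proof (cases "A = {}")
    case True
    then show ?thesis using that[of 1] by simp
  next
    case False
    then have "z ^ n = 1" using root z by fastforce
    moreover have "g x = z * base x" if "x \<in> A" for x using z[OF that] nz[OF that] by auto
    ultimately show ?thesis using that by blast
  qed
qed

text \<open>The phases on the intervals \<open>S j\<close> are free parameters and determine the
  function. Extensional functions are used so that phases outside \<open>J\<close> do not spoil
  injectivity.\<close>

theorem C_roots_base:
  assumes n: "n > 0"
  shows "bij_betw twisted (J \<rightarrow>\<^sub>E {z. z ^ n = 1}) (C_roots n base)"
proof -
  have norm_1: "norm z \<le> 1" if "z ^ n = 1" for z :: complex
    using power_eq_1_iff[OF that] n by auto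
  have "g \<in> twisted ` (J \<rightarrow>\<^sub>E {z. z ^ n = 1})" if g: "g \<in> C_roots n base" for g
  proof -
    have gCH: "g \<in> CH" and gn: "\<And>x. g x ^ n = base x ^ n" using g by (auto simp: C_roots_def)
    obtain z\<^sub>0 where z\<^sub>0: "\<And>x. x \<in> S\<^sub>0 \<Longrightarrow> g x = z\<^sub>0 * base x"
      by (rule root_quotient_constant[OF n g connected_S\<^sub>0]) (auto simp: nonzero_set_base)
    \<comment> \<open>The normalisation at the origin fixes the phase on the central interval, so
      only the phases indexed by \<open>J\<close> stay free.\<close>
    have z\<^sub>0_1: "z\<^sub>0 = 1"
      using z\<^sub>0[OF zero_in_S\<^sub>0] CH_zero[OF gCH] CH_zero[OF base_in_CH] by simp
    have "\<exists>z. z ^ n = 1 \<and> (\<forall>x\<in>S j. g x = z * base x)" if "j \<in> J" for j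
    proof -
      have "S j \<subseteq> nonzero_set base" using that by (auto simp: nonzero_set_base)
      then show ?thesis by (rule root_quotient_constant[OF n g connected_S[OF that]]) auto
    qed
    then obtain e where e: "\<And>j. j \<in> J \<Longrightarrow> e j ^ n = 1"
      "\<And>j x. j \<in> J \<Longrightarrow> x \<in> S j \<Longrightarrow> g x = e j * base x"
      by metis
    let ?e = "restrict e J"
    have "g = twisted ?e"
    proof (rule twisted_eqI[OF gCH])
      show "norm (?e j) \<le> 1" if "j \<in> J" for j using that e(1) norm_1 by simp
      fix x :: real assume x: "x \<ge> 0"
      consider "x \<in> S\<^sub>0" | j where "j \<in> J" "x \<in> S j" | "x \<notin> S\<^sub>0" "\<And>j. j \<in> J \<Longrightarrow> x \<notin> S j"
        by blast
      then show "g x = twisted ?e x"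
      proof cases
        case 1
        then show ?thesis using z\<^sub>0[OF 1] z\<^sub>0_1 twisted_on_S\<^sub>0[OF x 1] by simp
      next
        case 2
        then show ?thesis using e(2)[OF 2] by (simp add: twisted_on_S[OF 2])
      next
        case 3
        \<comment> \<open>Here \<open>base\<close> vanishes, so the \<open>n\<close>-th power of
          \<open>g x\<close> is \<open>0\<close> and hence so is \<open>g x\<close>.\<close>
        then show ?thesis using twisted_off_support[OF x 3] gn[of x] n by (simp add: zero_power)
      qed
    qed
    then show ?thesis using e(1) by auto
  qed
  moreover have "twisted e \<in> C_roots n base" if "e \<in> J \<rightarrow>\<^sub>E {z. z ^ n = 1}" for e
  proof -
    have root: "e j ^ n = 1" if "j \<in> J" for j using PiE_mem[OF \<open>e \<in> _\<close> that] by simp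
    then have "twisted e \<in> CH" by (intro twisted_in_CH norm_1)
    moreover have "twisted e x ^ n = base x ^ n" for x by (rule power_twisted[OF n root])
    ultimately show ?thesis unfolding C_roots_def by blast
  qed
  moreover have "inj_on twisted (J \<rightarrow>\<^sub>E {z. z ^ n = 1})"
    using twisted_inj by (intro inj_onI) (rule PiE_ext)
  ultimately show ?thesis unfolding bij_betw_def by blast
qed

corollary card_C_roots_base:
  assumes "n > 0"
  shows "card (C_roots n base) = n ^ card J"
  using bij_betw_same_card[OF C_roots_base[OF assms]] card_roots_unity_eq[OF assms]
  by (simp add: card_PiE finite_J)

end

section \<open>Realisation of the given intervals\<close>

lemma exists_base_density:
  assumes "b > (0::ereal)"
  obtains P :: "real \<Rightarrow> real" where "integrable lborel P" "\<And>t. P t \<ge> 0"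
    "fourier (\<lambda>t. complex_of_real (P t)) 0 = 1"
    "{x. fourier (\<lambda>t. complex_of_real (P t)) x \<noteq> 0} = einterval (- b) b"
    "\<And>a b'. b < \<infinity> \<Longrightarrow> ereal a < b' \<Longrightarrow>
      \<exists>q \<in> borel_measurable borel. (\<forall>t. norm (q t) \<le> P t) \<and> {x. fourier q x \<noteq> 0} = einterval a b'"
proof (cases b)
  case (real v)
  then have v: "v > 0" using assms by simp
  show ?thesis
  proof (rule that)
    show "integrable lborel (bump_kernel v)" by (rule integrable_bump_kernel[OF v])
    show "bump_kernel v t \<ge> 0" for t by (rule bump_kernel_nonneg[OF v])
    show "fourier (\<lambda>t. complex_of_real (bump_kernel v t)) 0 = 1"
      by (simp add: fourier_bump_kernel[OF v] bump_def)
    have "- b < ereal x \<and> ereal x < b \<longleftrightarrow> \<bar>x\<bar> < v" for x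
      unfolding real uminus_ereal.simps less_ereal.simps by linarith
    then show "{x. fourier (\<lambda>t. complex_of_real (bump_kernel v t)) x \<noteq> 0} = einterval (- b) b"
      unfolding fourier_bump_kernel[OF v] of_real_eq_0_iff bump_nonzero_iff[OF v] einterval_def by simp
    show "\<exists>q \<in> borel_measurable borel. (\<forall>t. norm (q t) \<le> bump_kernel v t) \<and>
      {x. fourier q x \<noteq> 0} = einterval a b'" if "ereal a < b'" for a b'
      by (rule exists_fourier_support[OF v that]) (rule bexI, intro conjI allI)
  qed
next
  \<comment> \<open>The whole line is not the support of a squared triangle, but the Gaussian
    transform vanishes nowhere. The domination clause, which assumes \<open>b < \<infinity>\<close>,
    is vacuous in this case.\<close>
  case PInf
  show ?thesis
  proof (rule that)
    show "integrable lborel std_normal_density" by simp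
    show "std_normal_density t \<ge> 0" for t by simp
    show "fourier (\<lambda>t. complex_of_real (std_normal_density t)) 0 = 1"
      by (simp add: fourier_std_normal_density)
    show "{x. fourier (\<lambda>t. complex_of_real (std_normal_density t)) x \<noteq> 0} = einterval (- b) b"
      unfolding fourier_std_normal_density PInf by (simp add: einterval_def)
  qed (simp add: PInf)
qed (use assms in simp)

lemma connected_einterval: "connected (einterval a b)"
proof (rule is_interval_connected, unfold is_interval_1, intro ballI allI impI)
  fix x y z :: real
  assume "x \<in> einterval a b" "y \<in> einterval a b" "x \<le> z \<and> z \<le> y"
  then have "a < ereal x" "ereal x \<le> ereal z" "ereal z \<le> ereal y" "ereal y < b"
    by (simp_all add: einterval_def)
  then show "z \<in> einterval a b"
    unfolding einterval_def mem_Collect_eq using less_le_trans le_less_trans by metis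
qed

text \<open>Extended reals admit an infinite last endpoint, while
  \<open>b (j - 1) < ereal (a j)\<close> keeps every earlier one below infinity.\<close>

theorem theorem1p3:
  fixes n k :: nat
    and a :: "nat \<Rightarrow> real"
    and b :: "nat \<Rightarrow> ereal"
    and E :: "int \<Rightarrow> real set"
  assumes "n \<ge> 2"
    and "b 0 > 0"
    and "\<And>j. 1 \<le> j \<Longrightarrow> j \<le> k \<Longrightarrow> b (j - 1) < ereal (a j) \<and> ereal (a j) < b j"
    and "E 0 = einterval (- b 0) (b 0)"
    and "\<And>j. 1 \<le> j \<Longrightarrow> j \<le> k \<Longrightarrow> E (int j) = einterval (ereal (a j)) (b j)"
    and "\<And>j. 1 \<le> j \<Longrightarrow> j \<le> k \<Longrightarrow> E (- int j) = uminus ` E (int j)"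
    and "disjoint_family_on E {- int k..int k}"
  shows "\<exists>f\<in>CH. nonzero_set f = (\<Union>j\<in>{- int k..int k}. E j) \<and>
           card (C_roots n f) = n ^ k"
proof -
  let ?J = "{1..k}"
  obtain P where P: "integrable lborel P" "\<And>t. P t \<ge> 0"
    "fourier (\<lambda>t. complex_of_real (P t)) 0 = 1"
    "{x. fourier (\<lambda>t. complex_of_real (P t)) x \<noteq> 0} = einterval (- b 0) (b 0)"
    "\<And>a b'. b 0 < \<infinity> \<Longrightarrow> ereal a < b' \<Longrightarrow>
      \<exists>q \<in> borel_measurable borel. (\<forall>t. norm (q t) \<le> P t) \<and> {x. fourier q x \<noteq> 0} = einterval a b'"
    by (rule exists_base_density[OF assms(2)]) (rule that)
  have "\<forall>j\<in>?J. \<exists>q. q \<in> borel_measurable borel \<and> (\<forall>t. norm (q t) \<le> P t) \<and>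
      {x. fourier q x \<noteq> 0} = E (int j)"
  proof
    fix j assume j: "j \<in> ?J"
    \<comment> \<open>The existence of an index in \<open>{1..k}\<close> forces the central interval
      to be bounded, which activates the domination clause for \<open>P\<close>.\<close>
    have "b 0 < ereal (a 1)" using assms(3)[of 1] j by simp
    then have "b 0 < \<infinity>" by (rule less_trans) simp
    moreover have "ereal (a j) < b j" "E (int j) = einterval (a j) (b j)"
      using assms(3,5)[of j] j by simp_all
    ultimately show "\<exists>q. q \<in> borel_measurable borel \<and> (\<forall>t. norm (q t) \<le> P t) \<and>
        {x. fourier q x \<noteq> 0} = E (int j)"
      using P(5)[of "a j" "b j"] by (simp only: Bex_def)
  qed
  from bchoice[OF this] obtain q where q: "\<forall>j\<in>?J. q j \<in> borel_measurable borel \<and>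
      (\<forall>t. norm (q j t) \<le> P t) \<and> {x. fourier (q j) x \<noteq> 0} = E (int j)" ..
  have b_pos: "b j > 0" if "j \<le> k" for j
    using that
  proof (induction j)
    case 0
    show ?case by (rule assms(2))
  next
    case (Suc j)
    then have "0 < b j" by simp
    also have "b j < b (Suc j)" using assms(3)[of "Suc j"] Suc.prems by force
    finally show ?case .
  qed
  have E_pos: "x > 0" if "j \<in> ?J" "x \<in> E (int j)" for j x
  proof -
    have "0 < b (j - 1)" using that(1) by (intro b_pos) auto
    also have "\<dots> < ereal (a j)" using assms(3)[of j] that(1) by simp
    also have "\<dots> < ereal x" using assms(5)[of j] that by (simp add: einterval_def)
    finally show ?thesis by simp
  qed
  have disjoint: "E i \<inter> E j = {}" if "i \<in> {- int k..int k}" "j \<in> {- int k..int k}" "i \<noteq> j" for i j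
    using assms(7) that by (auto simp: disjoint_family_on_def)
  \<comment> \<open>Only the intervals of positive index are supplied; those of negative index arise
    from Hermitian symmetry, so \<open>card ?J = k\<close> is the exponent.\<close>
  interpret dominated_spectrum P ?J q "E 0" "\<lambda>j. E (int j)"
  proof
    show "{x. fourier (\<lambda>t. complex_of_real (P t)) x \<noteq> 0} = E 0" using P(4) assms(4) by simp
    show "connected (E 0)" unfolding assms(4) by (rule connected_einterval)
    fix j assume j: "j \<in> ?J"
    then have E: "E (int j) = einterval (a j) (b j)" using assms(5) by simp
    show "connected (E (int j))" unfolding E by (rule connected_einterval)
    show "E (int j) \<noteq> {}"
      using assms(3)[of j] j ereal_dense2[of "a j" "b j"] unfolding E einterval_def by auto
    show "x \<notin> E 0" if "x \<in> E (int j)" for x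
      using disjoint[of "int j" 0] j that by auto
    show "i = j" if "i \<in> ?J" "x \<in> E (int i)" "x \<in> E (int j)" for i x
      using disjoint[of "int i" "int j"] j that by auto
    show "q j \<in> borel_measurable borel" "\<And>t. norm (q j t) \<le> P t"
      "{x. fourier (q j) x \<noteq> 0} = E (int j)"
      using q j by blast+
    show "x > 0" if "x \<in> E (int j)" for x
      using E_pos[OF j that] .
  qed (simp_all add: P)
  have "{- int k..int k} = insert 0 (int ` ?J \<union> (\<lambda>j. - int j) ` ?J)"
  proof (intro equalityI subsetI)
    fix i assume i: "i \<in> {- int k..int k}"
    show "i \<in> insert 0 (int ` ?J \<union> (\<lambda>j. - int j) ` ?J)"
    proof (cases i rule: int_cases3)
      case (pos m)
      then show ?thesis using i by auto
    next
      case (neg m)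
      then show ?thesis using i by auto
    qed simp
  qed auto
  then have "(\<Union>j\<in>{- int k..int k}. E j) = E 0 \<union> (\<Union>j\<in>?J. E (int j) \<union> E (- int j))"
    by auto
  also have "\<dots> = nonzero_set base"
    unfolding nonzero_set_base using assms(6) by auto
  finally have "nonzero_set base = (\<Union>j\<in>{- int k..int k}. E j)" ..
  moreover have "card (C_roots n base) = n ^ k"
    using card_C_roots_base[of n] assms(1) by simp
  ultimately show ?thesis using base_in_CH by blast
qed

end
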